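(* (a) For every integer $n\geq 9$, every linear subspace $X$ of $\ell_\infty^n$ of codimension $2$ (with the inherited norm) satisfies $e(X)\geq \dim X+1=n-1$. (b) For every integer $n\geq 15$, every linear subspace $X$ of $\ell_\infty^n$ of codimension $3$ (with the inherited norm) satisfies $e(X)\geq \dim X+1=n-2$.
   Context: $\ell_\infty^n$ denotes the real normed space $(\mathbb{R}^n,\|\cdot\|_\infty)$ with $\|x\|_\infty=\max_{1\le i\le n}|x_i|$. For a normed space $(X,\|\cdot\|)$ and $c>0$, a set $S\subseteq X$ is called $c$-equilateral if $\|x-y\|=c$ for all distinct $x,y\in S$; $S$ is called equilateral if it is $c$-equilateral for some $c>0$. The equilateral number $e(X)$ is the cardinality of the largest equilateral set in $X$. *)

theory Defs
  imports "HOL-Analysis.Analysis" "HOL-Library.Extended_Nat"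
begin

text \<open>
  The space \<open>\<ell>\<^sub>\<infinity>\<^sup>n\<close> is the type \<open>real ^ 'n\<close> with \<open>n = CARD('n)\<close>, equipped with \<^const>\<open>infnorm\<close>
  (the type-class norm on this type is the Euclidean one).
\<close>

lemma infnorm_eq_Max:
  fixes x :: "real ^ 'n"
  shows "infnorm x = Max (range (\<lambda>i. \<bar>x $ i\<bar>))"
proof -
  have "{\<bar>x $ i\<bar> |i. i \<in> UNIV} = range (\<lambda>i. \<bar>x $ i\<bar>)"
    by auto
  then show ?thesis
    by (simp add: infnorm_cart cSup_eq_Max)
qed

text \<open>
  Since the norm in question is not the type-class one, it is passed as an explicit parameter \<open>N\<close>.
\<close>

definition c_equilateral :: "('a::real_vector \<Rightarrow> real) \<Rightarrow> real \<Rightarrow> 'a set \<Rightarrow> bool" where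
  "c_equilateral N c S \<longleftrightarrow> (\<forall>x\<in>S. \<forall>y\<in>S. x \<noteq> y \<longrightarrow> N (x - y) = c)"

definition equilateral :: "('a::real_vector \<Rightarrow> real) \<Rightarrow> 'a set \<Rightarrow> bool" where
  "equilateral N S \<longleftrightarrow> (\<exists>c>0. c_equilateral N c S)"

text \<open>Unlike \<^const>\<open>card\<close>, this does not send infinite sets to \<open>0\<close>.\<close>

definition ecard :: "'a set \<Rightarrow> enat" where
  "ecard S = (if finite S then enat (card S) else \<infinity>)"

text \<open>
  The equilateral number of the normed space \<open>(X, N)\<close>.  In \<^typ>\<open>enat\<close> the supremum always exists,
  and it is attained whenever it is finite, so it is then the largest cardinality.
\<close>

definition equilateral_number :: "('a::real_vector \<Rightarrow> real) \<Rightarrow> 'a set \<Rightarrow> enat" where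
  "equilateral_number N X = (SUP S \<in> {S. S \<subseteq> X \<and> equilateral N S}. ecard S)"

definition codimension :: "'a::euclidean_space set \<Rightarrow> nat" where
  "codimension X = DIM('a) - dim X"

end

theory Submission
  imports Defs
begin

text \<open>
  A subspace of codimension \<open>k\<close> is the kernel of a surjective linear map \<open>f : \<real>\<^sup>n \<rightarrow> \<real>\<^sup>k\<close>.  Fix a block
  length \<open>l\<close> and choose \<open>k\<close> vectors \<open>W\<^sub>j\<close> with entries \<open>-1\<close>, \<open>0\<close>, \<open>1\<close>, disjoint supports and at most
  \<open>l\<close> nonzero entries each, such that the determinant of the \<open>f W\<^sub>j\<close> is as large as possible in
  absolute value; it is then nonzero.  Let \<open>R\<close> be the set of the remaining at least \<open>n - k l\<close>
  coordinates.  For \<open>S \<subseteq> R\<close> with at most \<open>l\<close> elements, the indicator vector of \<open>S\<close>, with signs \<open>s\<^sub>i\<close>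
  attached to its entries, could replace any \<open>W\<^sub>j\<close>; so by Cramer's rule and the maximality of the
  determinant, \<open>f (\<Sum>i\<in>S. s\<^sub>i e\<^sub>i) = \<Sum>j. t\<^sub>j f W\<^sub>j\<close> with \<open>\<bar>t\<^sub>j\<bar> \<le> 1\<close>
  (\<open>coordinates_in_maximal_system\<close>).  Hence \<open>x\<^sub>S = (\<Sum>i\<in>S. s\<^sub>i e\<^sub>i) - (\<Sum>j. t\<^sub>j W\<^sub>j)\<close> lies in the kernel.

  Two such points differ by exactly \<open>1\<close> on the symmetric difference of the two sets and agree
  elsewhere on \<open>R\<close>.  On the block of \<open>W\<^sub>j\<close> they differ by the difference of the two values of \<open>t\<^sub>j\<close>, which is at
  most \<open>1\<close> as soon as these have the same sign.  The signs \<open>s\<^sub>i\<close> can be chosen to make one of the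
  \<open>t\<^sub>j\<close> nonnegative throughout, so the pigeonhole principle on the signs of the others leaves an
  equilateral set containing at least a \<open>1 / 2\<^bsup>k - 1\<^esup>\<close> share of the points with \<open>S\<close> nonempty; the
  origin, which is \<open>x\<^sub>S\<close> for empty \<open>S\<close>, can always be added (\<open>equilateral_set_in_kernel\<close>).  With
  \<open>l = 2\<close> the resulting bound
  \<open>1 + (\<Sum>i=1..l. (n - k l) choose i) / 2\<^bsup>k - 1\<^esup>\<close> exceeds \<open>n - k\<close> for \<open>k = 2\<close>, \<open>n \<ge> 9\<close> and for
  \<open>k = 3\<close>, \<open>n \<ge> 15\<close>.
\<close>

section \<open>Subspaces as kernels\<close>

text \<open>
  The orthogonal complement of \<open>X\<close> has the dimension of the target, hence is the range of a linear
  isometry; its adjoint is the required map.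
\<close>

lemma subspace_eq_kernel:
  fixes X :: "'a::euclidean_space set"
  assumes "subspace X" and "codimension X = DIM('b)"
  obtains f :: "'a \<Rightarrow> 'b::euclidean_space" where "linear f" "surj f" "X = {x. f x = 0}"
proof -
  have "dim (orthogonal_comp X) + dim X = DIM('a)"
    using dim_subspace_orthogonal_to_vectors[OF \<open>subspace X\<close> subspace_UNIV]
    by (simp add: orthogonal_comp_def)
  then have "dim (UNIV :: 'b set) = dim (orthogonal_comp X)"
    using assms(2) by (simp add: codimension_def)
  then obtain g :: "'b \<Rightarrow> 'a" where "linear g" and g_range: "range g = orthogonal_comp X"
      and g_norm: "\<And>x. norm (g x) = norm x"
    by (rule isometries_subspaces[OF subspace_UNIV subspace_orthogonal_comp]) auto
  have "inj g"
    using \<open>linear g\<close> g_norm by (metis linear_injective_0 norm_eq_zero)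
  show ?thesis
  proof
    show "linear (adjoint g)"
      using \<open>linear g\<close> by (rule adjoint_linear)
    show "surj (adjoint g)"
      using \<open>linear g\<close> \<open>inj g\<close> by (simp add: surj_adjoint_iff_inj)
    have "adjoint g x = 0 \<longleftrightarrow> (\<forall>z\<in>range g. orthogonal z x)" for x
    proof -
      have "adjoint g x = 0 \<longleftrightarrow> (\<forall>y. y \<bullet> adjoint g x = 0)"
        by (metis inner_eq_zero_iff inner_zero_right)
      also have "\<dots> \<longleftrightarrow> (\<forall>z\<in>range g. orthogonal z x)"
        using adjoint_works[OF \<open>linear g\<close>] by (simp add: orthogonal_def inner_commute)
      finally show ?thesis .
    qed
    then have "{x. adjoint g x = 0} = orthogonal_comp (orthogonal_comp X)"
      by (simp add: g_range orthogonal_comp_def)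
    then show "X = {x. adjoint g x = 0}"
      using orthogonal_comp_self[OF \<open>subspace X\<close>] by simp
  qed
qed

text \<open>The images of the unit vectors span the target, so some of them form a basis.\<close>

lemma surj_nonzero_minor:
  fixes f :: "real ^ 'n \<Rightarrow> real ^ 'k"
  assumes "linear f" "surj f"
  obtains p :: "'k \<Rightarrow> 'n" where "inj p" "det (\<chi> j. f (axis (p j) 1)) \<noteq> 0"
proof -
  let ?C = "range (\<lambda>i. f (axis i 1))"
  have "?C = f ` Basis"
    by (auto simp: Basis_vec_def)
  then have "span ?C = UNIV"
    using assms by (simp add: linear_span_image)
  obtain B where B: "B \<subseteq> ?C" "independent B" "?C \<subseteq> span B" "card B = dim ?C"
    by (rule basis_exists)
  have "span B = UNIV"
    using \<open>span ?C = UNIV\<close> span_minimal[OF B(3) subspace_span] by auto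
  have "card B = CARD('k)"
    using B(4) dim_span[of ?C] \<open>span ?C = UNIV\<close> by simp
  then obtain b :: "'k \<Rightarrow> real ^ 'k" where b: "bij_betw b UNIV B"
    using finite_same_card_bij[OF finite finiteI_independent[OF B(2)]] by auto
  have "\<exists>i. b j = f (axis i 1)" for j
  proof -
    have "b j \<in> ?C"
      by (rule subsetD[OF B(1) bij_betw_apply[OF b UNIV_I]])
    then show ?thesis
      by (rule imageE) (rule exI)
  qed
  then have "\<forall>j. \<exists>i. b j = f (axis i 1)"
    by (rule allI)
  from choice[OF this] obtain p where p: "\<And>j. b j = f (axis (p j) 1)"
    by blast
  have "inj p"
    using bij_betw_imp_inj_on[OF b] by (auto simp: inj_def p)
  moreover have "rows (\<chi> j. b j) = B"
    using b by (auto simp: rows_def row_def bij_betw_def vec_lambda_beta)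
  then have "invertible (\<chi> j. b j)"
    using \<open>span B = UNIV\<close> by (simp add: invertible_left_inverse matrix_left_invertible_span_rows)
  ultimately show ?thesis
    using that by (simp add: p invertible_det_nz)
qed

section \<open>Disjoint sign vectors with maximal determinant\<close>

definition sign_vectors :: "nat \<Rightarrow> (real ^ 'n) set" where
  "sign_vectors l = {v. (\<forall>i. v $ i \<in> {-1, 0, 1}) \<and> card {i. v $ i \<noteq> 0} \<le> l}"

definition disjoint_sign_vectors :: "nat \<Rightarrow> ('k \<Rightarrow> real ^ 'n) set" where
  "disjoint_sign_vectors l =
    {W. (\<forall>j. W j \<in> sign_vectors l) \<and> (\<forall>j j' i. j \<noteq> j' \<longrightarrow> W j $ i = 0 \<or> W j' $ i = 0)}"

lemma finite_disjoint_sign_vectors: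
  "finite (disjoint_sign_vectors l :: ('k::finite \<Rightarrow> real ^ 'n) set)"
proof -
  let ?P = "PiE UNIV (\<lambda>_::'n. {-1, 0, 1 :: real})"
  have "(sign_vectors l :: (real ^ 'n) set) \<subseteq> vec_lambda ` ?P"
  proof
    fix v :: "real ^ 'n"
    assume "v \<in> sign_vectors l"
    then have "vec_nth v \<in> ?P" "v = vec_lambda (vec_nth v)"
      by (auto simp: sign_vectors_def)
    then show "v \<in> vec_lambda ` ?P"
      by blast
  qed
  moreover have "finite ?P"
    by (intro finite_PiE) auto
  ultimately have "finite (sign_vectors l :: (real ^ 'n) set)"
    by (meson finite_imageI finite_subset)
  then have "finite (PiE UNIV (\<lambda>_::'k. sign_vectors l :: (real ^ 'n) set))"
    by (intro finite_PiE) auto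
  moreover have "disjoint_sign_vectors l \<subseteq> PiE UNIV (\<lambda>_::'k. sign_vectors l :: (real ^ 'n) set)"
    by (auto simp: disjoint_sign_vectors_def)
  ultimately show ?thesis
    by (rule rev_finite_subset)
qed

text \<open>
  The maximum is nonzero because unit vectors at distinct positions are admissible for \<open>l \<ge> 1\<close>,
  and some choice of them has a nonzero determinant.
\<close>

lemma maximal_disjoint_sign_vectors:
  fixes f :: "real ^ 'n \<Rightarrow> real ^ 'k"
  assumes "linear f" "surj f" "l \<ge> 1"
  obtains W where "W \<in> disjoint_sign_vectors l" "det (\<chi> j. f (W j)) \<noteq> 0"
    "\<And>V. V \<in> disjoint_sign_vectors l \<Longrightarrow> \<bar>det (\<chi> j. f (V j))\<bar> \<le> \<bar>det (\<chi> j. f (W j))\<bar>"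
proof -
  let ?D = "disjoint_sign_vectors l :: ('k \<Rightarrow> real ^ 'n) set"
  let ?d = "\<lambda>W :: 'k \<Rightarrow> real ^ 'n. \<bar>det (\<chi> j. f (W j))\<bar>"
  obtain p :: "'k \<Rightarrow> 'n" where p: "inj p" "det (\<chi> j. f (axis (p j) 1)) \<noteq> 0"
    using assms surj_nonzero_minor by blast
  let ?U = "\<lambda>j. axis (p j) 1 :: real ^ 'n"
  have "{i. ?U j $ i \<noteq> 0} = {p j}" for j
    by (auto simp: axis_def)
  then have "?U j \<in> sign_vectors l" for j
    using \<open>l \<ge> 1\<close> by (auto simp: sign_vectors_def) (auto simp: axis_def)
  then have U: "?U \<in> ?D"
    using p(1) by (auto simp: disjoint_sign_vectors_def axis_def inj_def)
  have fin: "finite (?d ` ?D)"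
    by (simp add: finite_disjoint_sign_vectors)
  obtain W where W: "W \<in> ?D" "?d W = Max (?d ` ?D)"
    using Max_in[OF fin] U by (metis (mono_tags, lifting) empty_iff imageE image_is_empty)
  then have max: "?d V \<le> ?d W" if "V \<in> ?D" for V
    using fin that by simp
  then have "det (\<chi> j. f (W j)) \<noteq> 0"
    using max[OF U] p(2) by auto
  with W(1) max show ?thesis
    using that by blast
qed

text \<open>
  Replacing \<open>W j\<close> by \<open>v\<close> keeps the system admissible and, by Cramer's rule, multiplies the
  determinant by \<open>t $ j\<close>; maximality forbids a factor larger than \<open>1\<close> in absolute value.
\<close>

lemma coordinates_in_maximal_system:
  fixes f :: "real ^ 'n \<Rightarrow> real ^ 'k"
  assumes "linear f" and W: "W \<in> disjoint_sign_vectors l" and nz: "det (\<chi> j. f (W j)) \<noteq> 0"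
    and max: "\<And>V. V \<in> disjoint_sign_vectors l \<Longrightarrow> \<bar>det (\<chi> j. f (V j))\<bar> \<le> \<bar>det (\<chi> j. f (W j))\<bar>"
    and v: "v \<in> sign_vectors l" "\<And>i j. v $ i = 0 \<or> W j $ i = 0"
    and t: "f v = (\<Sum>j\<in>UNIV. t $ j *\<^sub>R f (W j))"
  shows "\<bar>t $ j\<bar> \<le> 1"
proof -
  let ?M = "\<chi> j. f (W j)"
  have upd: "W(j := v) \<in> disjoint_sign_vectors l"
    using W v unfolding disjoint_sign_vectors_def by (auto simp: fun_upd_def)
  have "(\<chi> j'. f ((W(j := v)) j')) =
      (\<chi> i. if i = j then (\<Sum>i\<in>UNIV. t $ i *s row i ?M) else row i ?M)"
    by (simp add: vec_eq_iff row_def t scalar_mult_eq_scaleR)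
  then have "det (\<chi> j'. f ((W(j := v)) j')) = t $ j * det ?M"
    using cramer_lemma_transpose[of j t ?M] by simp
  then have "\<bar>t $ j\<bar> * \<bar>det ?M\<bar> \<le> 1 * \<bar>det ?M\<bar>"
    using max[OF upd] by (simp add: abs_mult)
  then show ?thesis
    using nz by simp
qed

section \<open>Equilateral sets in kernels\<close>

lemma card_nonempty_subsets_upto:
  assumes "finite R"
  shows "card {S. S \<subseteq> R \<and> card S \<in> {1..l}} = (\<Sum>i=1..l. card R choose i)"
proof -
  have "{S. S \<subseteq> R \<and> card S \<in> {1..l}} = (\<Union>i\<in>{1..l}. {S. S \<subseteq> R \<and> card S = i})"
    by auto
  moreover have "card \<dots> = (\<Sum>i=1..l. card {S. S \<subseteq> R \<and> card S = i})"
  proof (rule card_UN_disjoint)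
    have "finite {S. S \<subseteq> R \<and> card S = i}" for i
      by (rule finite_subset[of _ "Pow R"]) (use assms in auto)
    then show "\<forall>i\<in>{1..l}. finite {S. S \<subseteq> R \<and> card S = i}"
      by blast
  qed auto
  ultimately show ?thesis
    using n_subsets[OF assms] by simp
qed

lemma infnorm_eq_1I:
  fixes v :: "real ^ 'n"
  assumes "\<And>i. \<bar>v $ i\<bar> \<le> 1" "\<bar>v $ i\<bar> = 1"
  shows "infnorm v = 1"
  unfolding infnorm_eq_Max
proof (rule Max_eqI)
  show "1 \<in> range (\<lambda>i. \<bar>v $ i\<bar>)"
    using assms(2) by (metis rangeI)
qed (use assms(1) in auto)

text \<open>
  Only \<open>k - 1\<close> of the \<open>k\<close> signs enter the pigeonhole argument, since the signs of the entries on \<open>R\<close>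
  can be adapted to one distinguished index \<open>j0\<close>.  The origin, accounting for the subtracted \<open>1\<close>, is
  compatible with every sign pattern.
\<close>

theorem equilateral_set_in_kernel:
  fixes f :: "real ^ 'n \<Rightarrow> real ^ 'k"
  assumes "linear f" "surj f" "l \<ge> 1"
  obtains E where "finite E" "E \<subseteq> {x. f x = 0}" "equilateral infnorm E"
    "(\<Sum>i=1..l. (CARD('n) - CARD('k) * l) choose i) \<le> 2 ^ (CARD('k) - 1) * (card E - 1)"
proof -
  obtain W where W: "W \<in> disjoint_sign_vectors l" and nz: "det (\<chi> j. f (W j)) \<noteq> 0"
    and max: "\<And>V. V \<in> disjoint_sign_vectors l \<Longrightarrow> \<bar>det (\<chi> j. f (V j))\<bar> \<le> \<bar>det (\<chi> j. f (W j))\<bar>"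
    using maximal_disjoint_sign_vectors[OF assms] by blast
  let ?supp = "\<lambda>j. {i. W j $ i \<noteq> 0}"
  have "card (\<Union>j. ?supp j) \<le> (\<Sum>j\<in>UNIV. card (?supp j))"
    by (rule card_UN_le) simp
  also have "\<dots> \<le> CARD('k) * l"
    using W sum_bounded_above[of UNIV "\<lambda>j. card (?supp j)" l]
    by (simp add: disjoint_sign_vectors_def sign_vectors_def)
  finally have "CARD('n) - CARD('k) * l \<le> card (- (\<Union>j. ?supp j))"
    by (simp add: Compl_eq_Diff_UNIV card_Diff_subset)
  then obtain R where R: "R \<subseteq> - (\<Union>j. ?supp j)" "card R = CARD('n) - CARD('k) * l"
    by (metis obtain_subset_with_card_n)
  have WR: "W j $ i = 0" if "i \<in> R" for i j
    using R(1) that by auto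

  \<comment> \<open>\<open>\<tau> y\<close> lists the coordinates of \<open>y\<close> in the basis of the \<open>f (W j)\<close>.\<close>
  let ?A = "transpose (\<chi> j. f (W j))"
  have "invertible ?A"
    using nz by (simp add: invertible_det_nz det_transpose)
  then obtain A' where A': "?A ** A' = mat 1"
    unfolding invertible_def by blast
  define \<tau> where "\<tau> y = A' *v y" for y
  have \<tau>: "y = (\<Sum>j\<in>UNIV. \<tau> y $ j *\<^sub>R f (W j))" for y
  proof -
    have "?A *v \<tau> y = y"
      by (simp add: \<tau>_def matrix_vector_mul_assoc A')
    then show ?thesis
      by (simp add: matrix_mult_sum column_def transpose_def scalar_mult_eq_scaleR vec_lambda_eta)
  qed
  have lin: "linear \<tau>"
    unfolding \<tau>_def by (rule matrix_vector_mul_linear)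

  obtain j0 :: 'k where True
    by simp
  \<comment> \<open>With these signs, every signed unit vector contributes nonnegatively to the coordinate \<open>j0\<close>.\<close>
  define s :: "'n \<Rightarrow> real" where "s i = (if \<tau> (f (axis i 1)) $ j0 \<ge> 0 then 1 else -1)" for i
  define v :: "'n set \<Rightarrow> real ^ 'n" where "v S = (\<chi> i. if i \<in> S then s i else 0)" for S
  define t where "t S = \<tau> (f (v S))" for S
  define x where "x S = v S - (\<Sum>j\<in>UNIV. t S $ j *\<^sub>R W j)" for S
  have s: "s i = 1 \<or> s i = -1" for i
    by (simp add: s_def)

  have v_sum: "v S = (\<Sum>i\<in>S. s i *\<^sub>R axis i 1)" for S
    by (simp add: v_def vec_eq_iff axis_def if_distrib sum.delta cong: if_cong)
  have t0: "t S $ j0 \<ge> 0" for S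
  proof -
    have "t S = (\<Sum>i\<in>S. s i *\<^sub>R \<tau> (f (axis i 1)))"
      by (simp add: t_def v_sum linear_sum[OF lin] linear_sum[OF \<open>linear f\<close>]
          linear_cmul[OF lin] linear_cmul[OF \<open>linear f\<close>])
    then show ?thesis
      by (simp add: s_def sum_nonneg)
  qed
  have kernel: "f (x S) = 0" for S
    using \<tau>[of "f (v S)"]
    by (simp add: x_def t_def linear_diff[OF \<open>linear f\<close>] linear_sum[OF \<open>linear f\<close>]
        linear_cmul[OF \<open>linear f\<close>])
  have t1: "\<bar>t S $ j\<bar> \<le> 1" if "S \<subseteq> R" "card S \<le> l" for S j
  proof (rule coordinates_in_maximal_system[OF \<open>linear f\<close> W nz max])
    have "{i. v S $ i \<noteq> 0} = S"
      by (auto simp: v_def s_def)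
    then show "v S \<in> sign_vectors l"
      using s that by (auto simp: sign_vectors_def v_def)
    show "v S $ i = 0 \<or> W j $ i = 0" for i j
      using that WR by (auto simp: v_def)
    show "f (v S) = (\<Sum>j\<in>UNIV. t S $ j *\<^sub>R f (W j))"
      unfolding t_def by (rule \<tau>)
  qed
  have x_R: "x S $ i = v S $ i" if "i \<in> R" for S i
    using that WR by (simp add: x_def)
  have x_block: "x S $ i = - (t S $ j * W j $ i)" if "W j $ i \<noteq> 0" "S \<subseteq> R" for S i j
  proof -
    have "W j' $ i = 0" if "j' \<noteq> j" for j'
      using W that \<open>W j $ i \<noteq> 0\<close> by (auto simp: disjoint_sign_vectors_def)
    then have "(\<Sum>j'\<in>UNIV. t S $ j' * W j' $ i) = (\<Sum>j'\<in>UNIV. if j' = j then t S $ j * W j $ i else 0)"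
      by (intro sum.cong) auto
    moreover have "i \<notin> S"
      using that WR by auto
    ultimately show ?thesis
      by (simp add: x_def v_def)
  qed
  have x_else: "x S $ i = 0" if "i \<notin> R" "\<And>j. W j $ i = 0" "S \<subseteq> R" for S i
    using that by (auto simp: x_def v_def)

  have dist: "infnorm (x S - x T) = 1"
    if ST: "S \<subseteq> R" "T \<subseteq> R" "card S \<le> l" "card T \<le> l" "S \<noteq> T"
      and same: "\<And>j. (t S $ j \<ge> 0 \<and> t T $ j \<ge> 0) \<or> (t S $ j \<le> 0 \<and> t T $ j \<le> 0)" for S T
  proof -
    obtain i where i: "i \<in> S \<longleftrightarrow> i \<notin> T"
      using \<open>S \<noteq> T\<close> by blast
    show ?thesis
    proof (rule infnorm_eq_1I)
      show "\<bar>(x S - x T) $ i\<bar> = 1"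
        using i ST(1,2) s[of i] x_R[of i S] x_R[of i T] by (auto simp: v_def)
    next
      fix i
      consider "i \<in> R" | j where "W j $ i \<noteq> 0" | "i \<notin> R" "\<And>j. W j $ i = 0"
        by blast
      then show "\<bar>(x S - x T) $ i\<bar> \<le> 1"
      proof cases
        case 1
        then show ?thesis
          using s[of i] x_R[of i S] x_R[of i T] by (auto simp: v_def)
      next
        case (2 j)
        have "W j $ i = 1 \<or> W j $ i = -1"
          using W 2 by (auto simp: disjoint_sign_vectors_def sign_vectors_def)
        then show ?thesis
          using x_block[OF 2 ST(1)] x_block[OF 2 ST(2)] same[of j]
            t1[OF ST(1,3), of j] t1[OF ST(2,4), of j] by auto
      next
        case 3
        then show ?thesis
          using x_else[OF 3] ST(1,2) by simp
      qed
    qed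
  qed

  define P where "P = {S. S \<subseteq> R \<and> card S \<in> {1..l}}"
  define q where "q S = {j. j \<noteq> j0 \<and> t S $ j \<ge> 0}" for S
  have "finite P"
    by simp
  have qP: "q \<in> P \<rightarrow> Pow (UNIV - {j0})"
    by (auto simp: q_def)
  have "finite (Pow (UNIV - {j0}))" "Pow (UNIV - {j0}) \<noteq> {}"
    by auto
  then obtain Q where Q: "card (q -` {Q} \<inter> P) * card (Pow (UNIV - {j0})) \<ge> card P"
    using pigeonhole_card[OF qP \<open>finite P\<close>] by blast
  define F where "F = q -` {Q} \<inter> P"
  have "card (Pow (UNIV - {j0})) = 2 ^ (CARD('k) - 1)"
    by (simp add: card_Pow card_Diff_singleton)
  with Q have F: "card P \<le> 2 ^ (CARD('k) - 1) * card F"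
    by (simp add: F_def mult.commute)

  have sub: "S \<subseteq> R \<and> card S \<le> l" if "S \<in> insert {} F" for S
    using that by (auto simp: F_def P_def)
  have t_empty: "t {} = 0"
    by (simp add: t_def v_sum linear_0[OF lin] linear_0[OF \<open>linear f\<close>])
  have same: "(t S $ j \<ge> 0 \<and> t T $ j \<ge> 0) \<or> (t S $ j \<le> 0 \<and> t T $ j \<le> 0)"
    if "S \<in> insert {} F" "T \<in> insert {} F" for S T j
  proof (cases "S = {} \<or> T = {}")
    case True
    then show ?thesis
      using t_empty by auto
  next
    case False
    then have "q S = Q" "q T = Q"
      using that by (auto simp: F_def)
    then have "j \<noteq> j0 \<Longrightarrow> t S $ j \<ge> 0 \<longleftrightarrow> t T $ j \<ge> 0"
      unfolding q_def by blast
    then show ?thesis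
      using t0 by (cases "j = j0") auto
  qed
  have dist': "infnorm (x S - x T) = 1" if "S \<in> insert {} F" "T \<in> insert {} F" "S \<noteq> T" for S T
    using sub[OF that(1)] sub[OF that(2)] that(3) same[OF that(1,2)] by (intro dist) auto
  have inj: "inj_on x (insert {} F)"
    by (rule inj_onI) (metis dist' diff_self infnorm_0 zero_neq_one)
  show ?thesis
  proof
    show "finite (x ` insert {} F)"
      by simp
    show "x ` insert {} F \<subseteq> {x. f x = 0}"
      using kernel by auto
    have "c_equilateral infnorm 1 (x ` insert {} F)"
      unfolding c_equilateral_def using dist' by blast
    then show "equilateral infnorm (x ` insert {} F)"
      unfolding equilateral_def by (intro exI[of _ 1]) simp
    have "{} \<notin> F"
      by (auto simp: F_def P_def)
    then have "card (x ` insert {} F) - 1 = card F"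
      using card_image[OF inj] by (simp add: F_def)
    then show "(\<Sum>i=1..l. (CARD('n) - CARD('k) * l) choose i)
        \<le> 2 ^ (CARD('k) - 1) * (card (x ` insert {} F) - 1)"
      using F card_nonempty_subsets_upto[of R l] R(2) by (simp add: P_def)
  qed
qed

section \<open>Equilateral numbers in small codimension\<close>

lemma equilateral_number_ge:
  assumes "S \<subseteq> X" "equilateral N S" "finite S" "m \<le> card S"
  shows "equilateral_number N X \<ge> enat m"
proof -
  have "enat m \<le> ecard S"
    using assms by (simp add: ecard_def)
  also have "\<dots> \<le> equilateral_number N X"
    unfolding equilateral_number_def using assms by (intro SUP_upper) auto
  finally show ?thesis .
qed

text \<open>
  The strict inequality makes the pigeonhole class contain more than \<open>m\<close> sets; together with the
  origin this gives \<open>m + 2\<close> points.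
\<close>

corollary equilateral_number_codimension:
  fixes X :: "(real ^ 'n) set"
  assumes "subspace X" "codimension X = CARD('k::finite)" "l \<ge> 1"
    and "2 ^ (CARD('k) - 1) * m < (\<Sum>i=1..l. (CARD('n) - CARD('k) * l) choose i)"
  shows "equilateral_number infnorm X \<ge> enat (m + 2)"
proof -
  have "codimension X = DIM(real ^ 'k)"
    using assms(2) by simp
  then obtain f :: "real ^ 'n \<Rightarrow> real ^ 'k" where f: "linear f" "surj f" "X = {x. f x = 0}"
    using subspace_eq_kernel[OF \<open>subspace X\<close>] by blast
  obtain E where E: "finite E" "E \<subseteq> {x. f x = 0}" "equilateral infnorm E"
    "(\<Sum>i=1..l. (CARD('n) - CARD('k) * l) choose i) \<le> 2 ^ (CARD('k) - 1) * (card E - 1)"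
    using equilateral_set_in_kernel[OF f(1,2) \<open>l \<ge> 1\<close>] by blast
  have "2 ^ (CARD('k) - 1) * m < 2 ^ (CARD('k) - 1) * (card E - 1)"
    using E(4) assms(4) by linarith
  then have "m < card E - 1"
    by simp
  then show ?thesis
    using E f(3) by (intro equilateral_number_ge[of E]) auto
qed

lemma double_sum_choose_upto_2: "2 * (\<Sum>i=1..2. m choose i) = m * (m + 1)"
proof -
  have "(\<Sum>i=1..2. m choose i) = m + (m choose 2)"
    by (simp add: numeral_2_eq_2)
  moreover have "2 * (m choose 2) = m * (m - 1)"
    by (cases m) (simp_all add: choose_two)
  ultimately show ?thesis
    by (cases m) (auto simp: algebra_simps)
qed

theorem mainTheorem4:
  shows "(CARD('n::finite) \<ge> 9 \<longrightarrow>
      (\<forall>X :: (real ^ 'n) set. subspace X \<and> codimension X = 2 \<longrightarrow>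
        equilateral_number infnorm X \<ge> enat (dim X + 1) \<and> dim X + 1 = CARD('n) - 1))
    \<and> (CARD('n) \<ge> 15 \<longrightarrow>
      (\<forall>X :: (real ^ 'n) set. subspace X \<and> codimension X = 3 \<longrightarrow>
        equilateral_number infnorm X \<ge> enat (dim X + 1) \<and> dim X + 1 = CARD('n) - 2))"
proof (intro conjI impI allI; elim conjE)
  fix X :: "(real ^ 'n) set"
  assume n: "CARD('n) \<ge> 9" and X: "subspace X" "codimension X = 2"
  show dim: "dim X + 1 = CARD('n) - 1"
    using X n by (simp add: codimension_def)
  define m where "m = CARD('n) - 4"
  have "m \<ge> 5"
    using n by (simp add: m_def)
  then have "2 * (2 * (m + 1)) < m * 6"
    by simp
  also have "m * 6 \<le> m * (m + 1)"
    using \<open>m \<ge> 5\<close> by (intro mult_le_mono2) simp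
  finally have "2 * (2 * (m + 1)) < m * (m + 1)" .
  then have "2 * (m + 1) < (\<Sum>i=1..2. m choose i)"
    using double_sum_choose_upto_2[of m] by linarith
  then have "enat (m + 1 + 2) \<le> equilateral_number infnorm X"
    using equilateral_number_codimension[where 'k = 2 and l = 2 and X = X and m = "m + 1"] X
    by (simp add: m_def)
  moreover have "dim X + 1 = m + 1 + 2"
    using dim n by (simp add: m_def)
  ultimately show "equilateral_number infnorm X \<ge> enat (dim X + 1)"
    by simp
next
  fix X :: "(real ^ 'n) set"
  assume n: "CARD('n) \<ge> 15" and X: "subspace X" "codimension X = 3"
  show dim: "dim X + 1 = CARD('n) - 2"
    using X n by (simp add: codimension_def)
  define m where "m = CARD('n) - 6"
  have "m \<ge> 9"
    using n by (simp add: m_def)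
  then have "2 * (4 * (m + 2)) < m * 10"
    by simp
  also have "m * 10 \<le> m * (m + 1)"
    using \<open>m \<ge> 9\<close> by (intro mult_le_mono2) simp
  finally have "2 * (4 * (m + 2)) < m * (m + 1)" .
  then have "4 * (m + 2) < (\<Sum>i=1..2. m choose i)"
    using double_sum_choose_upto_2[of m] by linarith
  then have "enat (m + 2 + 2) \<le> equilateral_number infnorm X"
    using equilateral_number_codimension[where 'k = 3 and l = 2 and X = X and m = "m + 2"] X
    by (simp add: m_def)
  moreover have "dim X + 1 = m + 2 + 2"
    using dim n by (simp add: m_def)
  ultimately show "equilateral_number infnorm X \<ge> enat (dim X + 1)"
    by simp
qed

end
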